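(* Let the function $f$ have a sufficient number of continuous derivatives in a neighborhood of $\alpha$, where $\alpha$ is a simple root of $f$. Then the iterative method $$x_{n+1}=x_n-f(x_n)\left[\frac{1+\sqrt{(1+f'(x_n)^2)(1+f'(y_n)^2)}-f'(x_n)f'(y_n)}{f'(x_n)+f'(y_n)}\right],\qquad y_n=x_n-\frac{f(x_n)}{f'(x_n)},$$ has third-order convergence.
   Context: Here $f$ is a real function of a real variable, and a simple root $\alpha$ of $f$ is a point with $f(\alpha)=0$ and $f'(\alpha)\neq 0$. Order of convergence is defined as follows: if $f$ is a real function with a simple root $\alpha$ and $(x_n)$ is a sequence of real numbers that converges towards $\alpha$, the order of convergence $m\in\mathbb{R}^+$ is given by $$\lim_{n\to\infty}\frac{x_{n+1}-\alpha}{(x_n-\alpha)^m}=\zeta\neq 0,$$ where $\zeta$ is the asymptotic error constant. Third-order convergence means $m=3$.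
   Formalization: Exact third order is asserted only when the asymptotic error constant is nonzero and the iterates never equal α, since it fails for f(x)=x, where the method hits the root in one step; otherwise local convergence with a cubic error bound is proved. *)

theory Defs
  imports "HOL-Analysis.Analysis"
begin

definition cont_differentiable_on :: "nat \<Rightarrow> (real \<Rightarrow> real) \<Rightarrow> real set \<Rightarrow> bool" where
  "cont_differentiable_on k f U \<longleftrightarrow>
     (\<forall>j<k. \<forall>x\<in>U. (deriv ^^ j) f differentiable at x) \<and> continuous_on U ((deriv ^^ k) f)"

definition simple_root :: "(real \<Rightarrow> real) \<Rightarrow> real \<Rightarrow> bool" where
  "simple_root f \<alpha> \<longleftrightarrow> f \<alpha> = 0 \<and> f differentiable at \<alpha> \<and> deriv f \<alpha> \<noteq> 0"

text \<open>
  The power in the definition of the order of convergence has a real exponent and a base that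
  may be negative. Since powr is only meant for positive bases, natural exponents are treated
  separately, so that the sign of the base is respected.
\<close>
definition real_power :: "real \<Rightarrow> real \<Rightarrow> real" where
  "real_power t m = (if m \<in> \<nat> then t ^ nat \<lfloor>m\<rfloor> else t powr m)"

text \<open>
  A nonzero limit of the quotients forces the terms of the sequence to differ from the root
  from some index on, so division by zero does not influence this definition.
\<close>
definition has_convergence_order ::
    "(real \<Rightarrow> real) \<Rightarrow> real \<Rightarrow> (nat \<Rightarrow> real) \<Rightarrow> real \<Rightarrow> bool" where
  "has_convergence_order f \<alpha> x m \<longleftrightarrow>
     simple_root f \<alpha> \<and> x \<longlonglongrightarrow> \<alpha> \<and> m > 0 \<and>
     (\<exists>\<zeta>. \<zeta> \<noteq> 0 \<and> (\<lambda>n. (x (Suc n) - \<alpha>) / real_power (x n - \<alpha>) m) \<longlonglongrightarrow> \<zeta>)"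

definition newton_step :: "(real \<Rightarrow> real) \<Rightarrow> real \<Rightarrow> real" where
  "newton_step f x = x - f x / deriv f x"

definition method_step :: "(real \<Rightarrow> real) \<Rightarrow> real \<Rightarrow> real" where
  "method_step f x =
     (let a = deriv f x; b = deriv f (newton_step f x)
      in x - f x * ((1 + sqrt ((1 + a\<^sup>2) * (1 + b\<^sup>2)) - a * b) / (a + b)))"

text \<open>
  The step is a genuine real expression: no division by zero, and the derivatives are taken
  at points of the set U on which f is assumed smooth.
\<close>
definition step_well_defined :: "(real \<Rightarrow> real) \<Rightarrow> real set \<Rightarrow> real \<Rightarrow> bool" where
  "step_well_defined f U x \<longleftrightarrow>
     x \<in> U \<and> newton_step f x \<in> U \<and> deriv f x \<noteq> 0 \<and>
     deriv f x + deriv f (newton_step f x) \<noteq> 0"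

definition method_sequence :: "(real \<Rightarrow> real) \<Rightarrow> (nat \<Rightarrow> real) \<Rightarrow> bool" where
  "method_sequence f x \<longleftrightarrow> (\<forall>n. x (Suc n) = method_step f (x n))"

text \<open>
  The asymptotic error constant of the method: with \<open>c\<^sub>j = f\<^bsup>(j)\<^esup>(\<alpha>) / (j! f'(\<alpha>))\<close> it is
  \<open>c\<^sub>2\<^sup>2 / (1 + f'(\<alpha>)\<^sup>2) + c\<^sub>3 / 2\<close>. It vanishes for some f, for example for
  linear f, where the method reaches the root in one step and the cubic quotients have no
  nonzero limit.
\<close>
definition error_constant :: "(real \<Rightarrow> real) \<Rightarrow> real \<Rightarrow> real" where
  "error_constant f \<alpha> =
     ((deriv ^^ 2) f \<alpha> / (fact 2 * deriv f \<alpha>))\<^sup>2 / (1 + (deriv f \<alpha>)\<^sup>2)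
     + ((deriv ^^ 3) f \<alpha> / (fact 3 * deriv f \<alpha>)) / 2"

end

theory Submission
  imports Defs
begin

text \<open>
  Write \<open>e = x - \<alpha>\<close>, \<open>a = f'(x)\<close>, \<open>b = f'(y)\<close>, \<open>S = sqrt ((1 + a\<^sup>2) (1 + b\<^sup>2))\<close>. The identities
  \<open>(1 + S - a b) (S - 1 + a b) = (a + b)\<^sup>2\<close> and \<open>S - (1 + a b) = (a - b)\<^sup>2 / (S + 1 + a b)\<close>
  turn the error of one step into
  \<open>e (1 + S - a b) / (a + b)\<^sup>2 * ((a - b)\<^sup>2 / (S + 1 + a b) + 2 a b - (f(x) / e) (a + b))\<close>,
  which contains no differences of square roots. The Taylor expansions of \<open>f\<close>, \<open>a\<close> and \<open>b\<close> at
  \<open>\<alpha>\<close> show that the last factor, divided by \<open>e\<^sup>2\<close>, has a limit. So the error of a step is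
  asymptotic to a constant times \<open>e ^ 3\<close>, and near \<open>\<alpha>\<close> the iteration at least halves the error.
\<close>

section \<open>Limits by l'Hospital's rule and the algebra of one step\<close>

text \<open>L'Hospital's rule raises the order of a limit by one; repeated use builds Taylor
  expansions whose scaled remainder has a limit. Differentiability at \<open>c\<close> itself makes
  \<open>g\<close> continuous there, so the numerator tends to \<open>0\<close>.\<close>

lemma tendsto_divide_power_Suc:
  fixes g g' :: "real \<Rightarrow> real"
  assumes "\<forall>\<^sub>F x in nhds c. (g has_real_derivative g' x) (at x)"
    and "g c = 0"
    and "((\<lambda>x. g' x / (x - c) ^ n) \<longlongrightarrow> L) (at c)"
  shows "((\<lambda>x. g x / (x - c) ^ Suc n) \<longlongrightarrow> L / Suc n) (at c)"
proof (rule lhopital)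
  have d: "(g has_real_derivative g' c) (at c)"
    using assms(1) by (rule eventually_nhds_x_imp_x)
  show "(g \<longlongrightarrow> 0) (at c)"
    using DERIV_isCont[OF d] assms(2) by (simp add: isCont_def)
  show "((\<lambda>x. (x - c) ^ Suc n) \<longlongrightarrow> 0) (at c)"
    by (auto intro!: tendsto_eq_intros)
  show "\<forall>\<^sub>F x in at c. (x - c) ^ Suc n \<noteq> 0"
    unfolding eventually_at_filter by (intro always_eventually) simp
  show "\<forall>\<^sub>F x in at c. real (Suc n) * (x - c) ^ n \<noteq> 0"
    unfolding eventually_at_filter by (intro always_eventually) simp
  show "\<forall>\<^sub>F x in at c. (g has_real_derivative g' x) (at x)"
    using assms(1) by (simp add: eventually_at_filter eventually_mono)
  show "\<forall>\<^sub>F x in at c. ((\<lambda>x. (x - c) ^ Suc n) has_real_derivative real (Suc n) * (x - c) ^ n) (at x)"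
  proof (intro always_eventually allI)
    fix x
    show "((\<lambda>x. (x - c) ^ Suc n) has_real_derivative real (Suc n) * (x - c) ^ n) (at x)"
      using DERIV_power_Suc[OF DERIV_diff[OF DERIV_ident DERIV_const[where k = c]], where n = n] by simp
  qed
  show "((\<lambda>x. g' x / (real (Suc n) * (x - c) ^ n)) \<longlongrightarrow> L / Suc n) (at c)"
    using tendsto_divide[OF assms(3) tendsto_const[of "real (Suc n)"]]
    by (simp add: mult.commute)
qed

text \<open>Here \<open>F\<close> stands for f(x) / e, so \<open>e * F\<close> is f(x). Both
  conjugate identities are differences of squares: \<open>S^2 - (1 + a * b)^2 = (a - b)^2\<close>
  and \<open>S^2 - (1 - a * b)^2 = (a + b)^2\<close>.\<close>

lemma step_error_identity:
  fixes a b e F :: real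
  defines "S \<equiv> sqrt ((1 + a\<^sup>2) * (1 + b\<^sup>2))"
  assumes "a + b \<noteq> 0" and "S + 1 + a * b \<noteq> 0"
  shows "e - e * F * ((1 + S - a * b) / (a + b)) =
    e * (1 + S - a * b) / (a + b)\<^sup>2 * ((a - b)\<^sup>2 / (S + 1 + a * b) + 2 * a * b - F * (a + b))"
proof -
  have S2: "S\<^sup>2 = (1 + a\<^sup>2) * (1 + b\<^sup>2)"
    by (simp add: S_def)
  have "(S - (1 + a * b)) * (S + 1 + a * b) = (a - b)\<^sup>2"
    using S2 by (simp add: power2_eq_square algebra_simps)
  then have 1: "(a - b)\<^sup>2 / (S + 1 + a * b) = S - (1 + a * b)"
    using assms(3) by (simp add: field_simps)
  have 2: "(1 + S - a * b) * (S - 1 + a * b) = (a + b)\<^sup>2"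
    using S2 by (simp add: power2_eq_square algebra_simps)
  have "e * (1 + S - a * b) / (a + b)\<^sup>2 * (S - (1 + a * b) + 2 * a * b - F * (a + b)) =
      e * ((1 + S - a * b) * (S - 1 + a * b)) / (a + b)\<^sup>2
      - e * F * ((1 + S - a * b) * (a + b) / (a + b)\<^sup>2)"
    by (simp add: algebra_simps add_divide_distrib diff_divide_distrib)
  also have "\<dots> = e - e * F * ((1 + S - a * b) / (a + b))"
    unfolding 2 using assms(2) by (simp add: power2_eq_square)
  finally show ?thesis
    unfolding 1 by simp
qed

text \<open>The variables \<rho>, \<beta>, \<phi> are the scaled second-order remainders of
  \<open>a\<close>, \<open>b\<close> and \<open>F\<close>. The expansion of \<open>b\<close> has no
  linear term, since the Newton step has an error of order \<open>e^2\<close>. The terms of order 0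
  and 1 cancel: \<open>2 * p^2 - 2 * p^2\<close> and \<open>2 * p * q - p * q - p * q\<close>. As
  the identity is exact, limits can be taken term by term.\<close>

lemma bracket_expansion_identity:
  fixes a b e F p q :: real
  assumes "e \<noteq> 0"
  defines "\<rho> \<equiv> (a - p - q * e) / e\<^sup>2" and "\<beta> \<equiv> (b - p) / e\<^sup>2"
    and "\<phi> \<equiv> (F - p - q / 2 * e) / e\<^sup>2"
  shows "(2 * a * b - F * (a + b)) / e\<^sup>2 =
    p * (\<rho> + \<beta>) - q\<^sup>2 / 2 - 2 * p * \<phi>
    + e * (2 * q * \<beta> - q / 2 * (\<rho> + \<beta>) - \<phi> * q) + e\<^sup>2 * (2 * \<rho> * \<beta> - \<phi> * (\<rho> + \<beta>))"
proof -
  have *: "a = p + q * e + \<rho> * e\<^sup>2" "b = p + \<beta> * e\<^sup>2" "F = p + q / 2 * e + \<phi> * e\<^sup>2"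
    using assms(1) by (simp_all add: \<rho>_def \<beta>_def \<phi>_def)
  have e2: "e\<^sup>2 \<noteq> 0"
    using assms(1) by simp
  show ?thesis
    unfolding *(1-3) nonzero_divide_eq_eq[OF e2]
    by (simp add: field_simps power2_eq_square)
qed

section \<open>Iterations with a cubic error bound\<close>

text \<open>Within distance \<epsilon> of \<alpha>, the factor
  \<open>K * \<bar>t - \<alpha>\<bar>^2\<close> is at most 1/2, so \<open>G\<close> at least halves
  the distance to \<alpha>.\<close>

lemma cubic_convergence:
  fixes x :: "nat \<Rightarrow> real"
  assumes "\<And>t. \<bar>t - \<alpha>\<bar> < \<epsilon> \<Longrightarrow> \<bar>G t - \<alpha>\<bar> \<le> K * \<bar>t - \<alpha>\<bar> ^ 3"
    and "K * \<epsilon>\<^sup>2 \<le> 1 / 2" and "K \<ge> 0"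
    and "\<And>n. x (Suc n) = G (x n)" and "\<bar>x 0 - \<alpha>\<bar> < \<epsilon>"
  shows "\<bar>x n - \<alpha>\<bar> < \<epsilon>" and "x \<longlonglongrightarrow> \<alpha>"
proof -
  have halve: "\<bar>G t - \<alpha>\<bar> \<le> \<bar>t - \<alpha>\<bar> / 2" if t: "\<bar>t - \<alpha>\<bar> < \<epsilon>" for t
  proof -
    have "\<bar>t - \<alpha>\<bar>\<^sup>2 \<le> \<epsilon>\<^sup>2"
      using t by (intro power_mono) auto
    then have "K * \<bar>t - \<alpha>\<bar>\<^sup>2 \<le> 1 / 2"
      using mult_left_mono[OF _ assms(3)] assms(2) by fastforce
    then have "K * \<bar>t - \<alpha>\<bar>\<^sup>2 * \<bar>t - \<alpha>\<bar> \<le> 1 / 2 * \<bar>t - \<alpha>\<bar>"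
      by (rule mult_right_mono) simp
    then show ?thesis
      using assms(1)[OF t] by (simp add: power2_eq_square power3_eq_cube mult.assoc)
  qed
  \<comment> \<open>Both claims go through one induction, because halving is available only while
    the iterate stays within \<epsilon>.\<close>
  have bound: "\<bar>x n - \<alpha>\<bar> < \<epsilon> \<and> \<bar>x n - \<alpha>\<bar> \<le> \<bar>x 0 - \<alpha>\<bar> * (1 / 2) ^ n" for n
  proof (induction n)
    case 0
    then show ?case using assms(5) by simp
  next
    case (Suc n)
    then show ?case using halve[of "x n"] abs_ge_zero[of "G (x n) - \<alpha>"] by (simp add: assms(4) del: abs_ge_zero)
  qed
  show "\<bar>x n - \<alpha>\<bar> < \<epsilon>"
    using bound by blast
  have "(\<lambda>n. \<bar>x 0 - \<alpha>\<bar> * (1 / 2) ^ n) \<longlonglongrightarrow> 0"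
    by (intro tendsto_mult_right_zero LIMSEQ_power_zero) simp
  then have "(\<lambda>n. x n - \<alpha>) \<longlonglongrightarrow> 0"
    by (rule Lim_null_comparison[rotated]) (use bound in simp)
  then show "x \<longlonglongrightarrow> \<alpha>"
    using LIM_zero_iff by blast
qed

section \<open>Taylor expansions and continuity at the root\<close>

context
  fixes f :: "real \<Rightarrow> real" and \<alpha> :: real and U :: "real set"
  assumes U: "open U" "\<alpha> \<in> U"
    and smooth: "cont_differentiable_on 3 f U"
    and root: "simple_root f \<alpha>"
begin

lemma domain_derivatives:
  assumes "x \<in> U"
  shows "(f has_real_derivative deriv f x) (at x)"
    and "(deriv f has_real_derivative (deriv ^^ 2) f x) (at x)"
    and "((deriv ^^ 2) f has_real_derivative (deriv ^^ 3) f x) (at x)"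
proof -
  have "\<forall>j<3. (deriv ^^ j) f differentiable at x"
    using smooth assms by (auto simp: cont_differentiable_on_def)
  then have "f differentiable at x" "deriv f differentiable at x" "(deriv ^^ 2) f differentiable at x"
    by (force dest: spec[of _ 0], force dest: spec[of _ 1], force dest: spec[of _ 2])
  then show "(f has_real_derivative deriv f x) (at x)"
    "(deriv f has_real_derivative (deriv ^^ 2) f x) (at x)"
    "((deriv ^^ 2) f has_real_derivative (deriv ^^ 3) f x) (at x)"
    using DERIV_deriv_iff_real_differentiable by (auto simp: numeral_eq_Suc)
qed

lemma root_values: "f \<alpha> = 0" "deriv f \<alpha> \<noteq> 0"
  using root by (simp_all add: simple_root_def)

lemma eventually_in_domain: "\<forall>\<^sub>F x in nhds \<alpha>. x \<in> U"
  using U by (rule eventually_nhds_in_open)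

text \<open>The difference quotient of the second derivative tends to the third derivative at
  \<alpha>; one use of l'Hospital's rule contributes the factor 1/2.\<close>

lemma deriv_expansion:
  "((\<lambda>x. (deriv f x - deriv f \<alpha> - (deriv ^^ 2) f \<alpha> * (x - \<alpha>)) / (x - \<alpha>)\<^sup>2) \<longlongrightarrow>
    (deriv ^^ 3) f \<alpha> / 2) (at \<alpha>)"
proof -
  have "((\<lambda>x. ((deriv ^^ 2) f x - (deriv ^^ 2) f \<alpha>) / (x - \<alpha>) ^ 1) \<longlongrightarrow> (deriv ^^ 3) f \<alpha>) (at \<alpha>)"
    using domain_derivatives(3)[OF U(2)] by (simp add: has_field_derivative_iff)
  moreover have "\<forall>\<^sub>F x in nhds \<alpha>. ((\<lambda>x. deriv f x - deriv f \<alpha> - (deriv ^^ 2) f \<alpha> * (x - \<alpha>))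
      has_real_derivative (deriv ^^ 2) f x - (deriv ^^ 2) f \<alpha>) (at x)"
    using eventually_in_domain
    by eventually_elim (auto intro!: derivative_eq_intros domain_derivatives)
  ultimately show ?thesis
    using tendsto_divide_power_Suc[of "\<lambda>x. deriv f x - deriv f \<alpha> - (deriv ^^ 2) f \<alpha> * (x - \<alpha>)"
        "\<lambda>x. (deriv ^^ 2) f x - (deriv ^^ 2) f \<alpha>" \<alpha> 1 "(deriv ^^ 3) f \<alpha>"]
    by (simp add: numeral_2_eq_2)
qed

text \<open>The quadratic Taylor remainder of \<open>f\<close> has the numerator of
  \<open>deriv_expansion\<close> as its derivative, so l'Hospital's rule gives
  \<open>1 / 2 / 3 = 1 / 6\<close>. Cancelling one factor \<open>x - \<alpha>\<close> leaves the
  quotient f(x) / e that enters the step error.\<close>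

lemma quotient_expansion:
  "((\<lambda>x. (f x / (x - \<alpha>) - deriv f \<alpha> - (deriv ^^ 2) f \<alpha> / 2 * (x - \<alpha>)) / (x - \<alpha>)\<^sup>2) \<longlongrightarrow>
    (deriv ^^ 3) f \<alpha> / 6) (at \<alpha>)"
proof -
  have "\<forall>\<^sub>F x in nhds \<alpha>. ((\<lambda>x. f x - deriv f \<alpha> * (x - \<alpha>) - (deriv ^^ 2) f \<alpha> / 2 * (x - \<alpha>)\<^sup>2)
      has_real_derivative deriv f x - deriv f \<alpha> - (deriv ^^ 2) f \<alpha> * (x - \<alpha>)) (at x)"
    using eventually_in_domain
    by eventually_elim (auto intro!: derivative_eq_intros domain_derivatives)
  from tendsto_divide_power_Suc[OF this _ deriv_expansion]
  have "((\<lambda>x. (f x - deriv f \<alpha> * (x - \<alpha>) - (deriv ^^ 2) f \<alpha> / 2 * (x - \<alpha>)\<^sup>2) / (x - \<alpha>) ^ 3) \<longlongrightarrow>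
      (deriv ^^ 3) f \<alpha> / 6) (at \<alpha>)"
    by (simp add: root_values numeral_3_eq_3)
  then show ?thesis
  proof (rule Lim_transform_eventually)
    show "\<forall>\<^sub>F x in at \<alpha>. (f x - deriv f \<alpha> * (x - \<alpha>) - (deriv ^^ 2) f \<alpha> / 2 * (x - \<alpha>)\<^sup>2) / (x - \<alpha>) ^ 3 =
        (f x / (x - \<alpha>) - deriv f \<alpha> - (deriv ^^ 2) f \<alpha> / 2 * (x - \<alpha>)) / (x - \<alpha>)\<^sup>2"
    proof (unfold eventually_at_filter, intro always_eventually allI impI)
      fix x assume "x \<noteq> \<alpha>"
      define e where "e = x - \<alpha>"
      have "e \<noteq> 0" using \<open>x \<noteq> \<alpha>\<close> by (simp add: e_def)
      then show "(f x - deriv f \<alpha> * (x - \<alpha>) - (deriv ^^ 2) f \<alpha> / 2 * (x - \<alpha>)\<^sup>2) / (x - \<alpha>) ^ 3 =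
        (f x / (x - \<alpha>) - deriv f \<alpha> - (deriv ^^ 2) f \<alpha> / 2 * (x - \<alpha>)) / (x - \<alpha>)\<^sup>2"
        unfolding e_def[symmetric]
        by (simp add: diff_divide_distrib power2_eq_square power3_eq_cube)
    qed
  qed
qed

lemma isCont_root:
  "isCont f \<alpha>" "isCont (deriv f) \<alpha>" "isCont (newton_step f) \<alpha>"
  "isCont (\<lambda>x. deriv f (newton_step f x)) \<alpha>"
proof -
  show 1: "isCont f \<alpha>" "isCont (deriv f) \<alpha>"
    using domain_derivatives[OF U(2)] DERIV_isCont by blast+
  show 2: "isCont (newton_step f) \<alpha>"
    unfolding newton_step_def by (intro continuous_intros 1 root_values)
  \<comment> \<open>The Newton step fixes \<alpha>, so continuity of \<open>deriv f\<close> is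
    called for at \<alpha> only.\<close>
  show "isCont (\<lambda>x. deriv f (newton_step f x)) \<alpha>"
    by (rule isCont_o2[OF 2]) (simp add: newton_step_def root_values 1)
qed

lemma newton_step_root: "newton_step f \<alpha> = \<alpha>"
  by (simp add: newton_step_def root_values)

lemma eventually_step_well_defined: "\<forall>\<^sub>F x in nhds \<alpha>. step_well_defined f U x"
proof -
  \<comment> \<open>Limits along \<open>nhds \<alpha>\<close> rather than \<open>at \<alpha>\<close>
    include the point \<alpha> itself, which is an admissible starting value.\<close>
  have lim: "(deriv f \<longlongrightarrow> deriv f \<alpha>) (nhds \<alpha>)" "(newton_step f \<longlongrightarrow> \<alpha>) (nhds \<alpha>)"
    "((\<lambda>x. deriv f (newton_step f x)) \<longlongrightarrow> deriv f \<alpha>) (nhds \<alpha>)"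
    using isCont_root by (simp_all add: continuous_at newton_step_root tendsto_nhds_iff)
  have sum: "((\<lambda>x. deriv f x + deriv f (newton_step f x)) \<longlongrightarrow> deriv f \<alpha> + deriv f \<alpha>) (nhds \<alpha>)"
    by (intro tendsto_add lim)
  have "\<forall>\<^sub>F x in nhds \<alpha>. deriv f x + deriv f (newton_step f x) \<noteq> 0"
    using root_values by (intro tendsto_imp_eventually_ne[OF sum]) simp
  moreover have "\<forall>\<^sub>F x in nhds \<alpha>. deriv f x \<noteq> 0"
    by (rule tendsto_imp_eventually_ne[OF lim(1) root_values(2)])
  moreover have "\<forall>\<^sub>F x in nhds \<alpha>. newton_step f x \<in> U"
    by (rule topological_tendstoD[OF lim(2) U])
  ultimately show ?thesis
    using eventually_in_domain by eventually_elim (simp add: step_well_defined_def)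
qed

section \<open>Asymptotic error of one step\<close>

text \<open>The Newton error is asymptotic to \<open>q / (2 * p) * e^2\<close>, and
  \<open>deriv f\<close> has slope \<open>q\<close> at \<alpha>; the limit is the product of the two
  coefficients.\<close>

lemma newton_deriv_expansion:
  "((\<lambda>x. (deriv f (newton_step f x) - deriv f \<alpha>) / (x - \<alpha>)\<^sup>2) \<longlongrightarrow>
    ((deriv ^^ 2) f \<alpha>)\<^sup>2 / (2 * deriv f \<alpha>)) (at \<alpha>)"
proof -
  define p q r where "p = deriv f \<alpha>" and "q = (deriv ^^ 2) f \<alpha>" and "r = (deriv ^^ 3) f \<alpha>"
  have p: "p \<noteq> 0" using root_values by (simp add: p_def)
  \<comment> \<open>Caratheodory's slope function avoids division by the Newton error, which may
    vanish away from \<alpha>.\<close>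
  obtain g where g: "\<And>z. deriv f z - p = g z * (z - \<alpha>)" "isCont g \<alpha>" "g \<alpha> = q"
    using domain_derivatives(2)[OF U(2)] unfolding CARAT_DERIV p_def q_def by auto
  have "isCont (\<lambda>x. g (newton_step f x)) \<alpha>"
    by (rule isCont_o2[OF isCont_root(3)]) (simp add: newton_step_root g)
  then have glim: "((\<lambda>x. g (newton_step f x)) \<longlongrightarrow> q) (at \<alpha>)"
    by (simp add: isCont_def newton_step_root g)
  have alim: "(deriv f \<longlongrightarrow> p) (at \<alpha>)"
    using isCont_root(2) by (simp add: isCont_def p_def)
  define \<rho> where "\<rho> = (\<lambda>x. (deriv f x - p - q * (x - \<alpha>)) / (x - \<alpha>)\<^sup>2)"
  define \<phi> where "\<phi> = (\<lambda>x. (f x / (x - \<alpha>) - p - q / 2 * (x - \<alpha>)) / (x - \<alpha>)\<^sup>2)"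
  have lims: "(\<rho> \<longlongrightarrow> r / 2) (at \<alpha>)" "(\<phi> \<longlongrightarrow> r / 6) (at \<alpha>)"
    using deriv_expansion quotient_expansion by (simp_all add: \<rho>_def \<phi>_def p_def q_def r_def)
  have "((\<lambda>x. g (newton_step f x) * ((q / 2 + (x - \<alpha>) * (\<rho> x - \<phi> x)) / deriv f x))
      \<longlongrightarrow> q * ((q / 2 + (\<alpha> - \<alpha>) * (r / 2 - r / 6)) / p)) (at \<alpha>)"
    by (intro tendsto_intros glim alim lims p)
  then have "((\<lambda>x. g (newton_step f x) * ((q / 2 + (x - \<alpha>) * (\<rho> x - \<phi> x)) / deriv f x))
      \<longlongrightarrow> q\<^sup>2 / (2 * p)) (at \<alpha>)"
    by (simp add: power2_eq_square)
  moreover have "\<forall>\<^sub>F x in at \<alpha>. g (newton_step f x) * ((q / 2 + (x - \<alpha>) * (\<rho> x - \<phi> x)) / deriv f x)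
      = (deriv f (newton_step f x) - p) / (x - \<alpha>)\<^sup>2"
    using tendsto_imp_eventually_ne[OF alim p] eventually_neq_at_within[of \<alpha>]
  proof eventually_elim
    case (elim x)
    define e a where "e = x - \<alpha>" and "a = deriv f x"
    have e: "e \<noteq> 0" "a \<noteq> 0" using elim by (simp_all add: e_def a_def)
    \<comment> \<open>Subtracting the expansions of f'(x) and f(x) / e cancels \<open>p\<close>.
      Dividing by \<open>a\<close> as well gives the Newton error over \<open>e^2\<close>.\<close>
    have "q / 2 + e * (\<rho> x - \<phi> x) = (a - f x / e) / e"
      unfolding \<rho>_def \<phi>_def e_def[symmetric] a_def[symmetric] using e
      by (simp add: field_simps power2_eq_square)
    moreover have "newton_step f x - \<alpha> = e - f x / a"
      by (simp add: newton_step_def e_def a_def)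
    moreover have "(a - f x / e) / e / a = (e - f x / a) / e\<^sup>2"
      using e by (simp add: field_simps power2_eq_square)
    ultimately show ?case
      unfolding g(1) e_def[symmetric] a_def[symmetric] by simp
  qed
  ultimately have "((\<lambda>x. (deriv f (newton_step f x) - p) / (x - \<alpha>)\<^sup>2) \<longlongrightarrow> q\<^sup>2 / (2 * p)) (at \<alpha>)"
    by (rule Lim_transform_eventually)
  then show ?thesis by (simp only: p_def q_def)
qed

text \<open>After division by \<open>e^3\<close>, the prefactor tends to
  \<open>1 / (2 * p^2)\<close>, the square-root term to \<open>q^2 / (2 * (1 + p^2))\<close> and the
  bracket \<open>T\<close> to \<open>p * r / 6\<close>. The product of the first with the sum of the
  others is the error constant.\<close>

lemma method_step_error:
  "((\<lambda>x. (method_step f x - \<alpha>) / (x - \<alpha>) ^ 3) \<longlongrightarrow> error_constant f \<alpha>) (at \<alpha>)"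
proof -
  define p q r where "p = deriv f \<alpha>" and "q = (deriv ^^ 2) f \<alpha>" and "r = (deriv ^^ 3) f \<alpha>"
  define a b where "a = deriv f" and "b = (\<lambda>x. deriv f (newton_step f x))"
  define \<rho> where "\<rho> = (\<lambda>x. (a x - p - q * (x - \<alpha>)) / (x - \<alpha>)\<^sup>2)"
  define \<phi> where "\<phi> = (\<lambda>x. (f x / (x - \<alpha>) - p - q / 2 * (x - \<alpha>)) / (x - \<alpha>)\<^sup>2)"
  define \<beta> where "\<beta> = (\<lambda>x. (b x - p) / (x - \<alpha>)\<^sup>2)"
  define S where "S x = sqrt ((1 + (a x)\<^sup>2) * (1 + (b x)\<^sup>2))" for x
  define T where "T x = p * (\<rho> x + \<beta> x) - q\<^sup>2 / 2 - 2 * p * \<phi> x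
      + (x - \<alpha>) * (2 * q * \<beta> x - q / 2 * (\<rho> x + \<beta> x) - \<phi> x * q)
      + (x - \<alpha>)\<^sup>2 * (2 * \<rho> x * \<beta> x - \<phi> x * (\<rho> x + \<beta> x))" for x
  have p: "p \<noteq> 0" using root_values by (simp add: p_def)
  have pp: "1 + p\<^sup>2 \<noteq> 0"
    using zero_le_power2[of p] by linarith
  have \<rho>: "(\<rho> \<longlongrightarrow> r / 2) (at \<alpha>)" and \<phi>: "(\<phi> \<longlongrightarrow> r / 6) (at \<alpha>)" and \<beta>: "(\<beta> \<longlongrightarrow> q\<^sup>2 / (2 * p)) (at \<alpha>)"
    using deriv_expansion quotient_expansion newton_deriv_expansion
    by (simp_all add: \<rho>_def \<phi>_def \<beta>_def p_def q_def r_def a_def b_def)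
  have a: "(a \<longlongrightarrow> p) (at \<alpha>)" and b: "(b \<longlongrightarrow> p) (at \<alpha>)"
    using isCont_root(2,4) by (simp_all add: isCont_def p_def a_def b_def newton_step_root)
  have "(S \<longlongrightarrow> sqrt ((1 + p\<^sup>2) * (1 + p\<^sup>2))) (at \<alpha>)"
    unfolding S_def by (intro tendsto_intros a b)
  then have S: "(S \<longlongrightarrow> 1 + p\<^sup>2) (at \<alpha>)"
    by (simp add: real_sqrt_mult_self)
  have T: "(T \<longlongrightarrow> p * r / 6) (at \<alpha>)"
  proof -
    have "(T \<longlongrightarrow> p * (r / 2 + q\<^sup>2 / (2 * p)) - q\<^sup>2 / 2 - 2 * p * (r / 6)
      + (\<alpha> - \<alpha>) * (2 * q * (q\<^sup>2 / (2 * p)) - q / 2 * (r / 2 + q\<^sup>2 / (2 * p)) - r / 6 * q)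
      + (\<alpha> - \<alpha>)\<^sup>2 * (2 * (r / 2) * (q\<^sup>2 / (2 * p)) - r / 6 * (r / 2 + q\<^sup>2 / (2 * p)))) (at \<alpha>)"
      unfolding T_def by (intro tendsto_intros \<rho> \<phi> \<beta>)
    \<comment> \<open>The contribution of \<beta> cancels \<open>q^2 / 2\<close>, leaving
      \<open>p * r / 2 - p * r / 3\<close>.\<close>
    moreover have "p * (r / 2 + q\<^sup>2 / (2 * p)) - q\<^sup>2 / 2 - 2 * p * (r / 6) = p * r / 6"
      using p by (simp add: field_simps)
    ultimately show ?thesis
      by (simp only: diff_self mult_zero_left zero_power2 add_0_right)
  qed
  have "((\<lambda>x. (deriv f x - deriv f \<alpha>) / (x - \<alpha>)) \<longlongrightarrow> q) (at \<alpha>)"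
    using domain_derivatives(2)[OF U(2)] by (simp add: has_field_derivative_iff q_def)
  then have A: "((\<lambda>x. (a x - p) / (x - \<alpha>)) \<longlongrightarrow> q) (at \<alpha>)"
    by (simp add: a_def p_def)
  \<comment> \<open>This expression is \<open>(a x - b x) / (x - \<alpha>)\<close>, written so that
    its limit follows from those already known.\<close>
  have "((\<lambda>x. (a x - p) / (x - \<alpha>) - (x - \<alpha>) * \<beta> x) \<longlongrightarrow> q - (\<alpha> - \<alpha>) * (q\<^sup>2 / (2 * p))) (at \<alpha>)"
    by (intro tendsto_intros A \<beta>)
  then have D: "((\<lambda>x. (a x - p) / (x - \<alpha>) - (x - \<alpha>) * \<beta> x) \<longlongrightarrow> q) (at \<alpha>)"
    by simp
  have den: "((\<lambda>x. S x + 1 + a x * b x) \<longlongrightarrow> 1 + p\<^sup>2 + 1 + p * p) (at \<alpha>)"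
    by (intro tendsto_intros S a b)
  have den0: "1 + p\<^sup>2 + 1 + p * p \<noteq> 0"
    using zero_le_square[of p] unfolding power2_eq_square by linarith
  have sum: "((\<lambda>x. a x + b x) \<longlongrightarrow> p + p) (at \<alpha>)"
    by (intro tendsto_intros a b)
  have "((\<lambda>x. (1 + S x - a x * b x) / (a x + b x)\<^sup>2 *
        (((a x - p) / (x - \<alpha>) - (x - \<alpha>) * \<beta> x)\<^sup>2 / (S x + 1 + a x * b x) + T x)) \<longlongrightarrow>
      (1 + (1 + p\<^sup>2) - p * p) / (p + p)\<^sup>2 * (q\<^sup>2 / (1 + p\<^sup>2 + 1 + p * p) + p * r / 6)) (at \<alpha>)"
    by (intro tendsto_intros S T D a b den0) (use p in auto)
  moreover have "(1 + (1 + p\<^sup>2) - p * p) / (p + p)\<^sup>2 * (q\<^sup>2 / (1 + p\<^sup>2 + 1 + p * p) + p * r / 6)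
      = error_constant f \<alpha>"
  proof -
    have "1 + p\<^sup>2 + 1 + p * p = 2 * (1 + p\<^sup>2)" "1 + (1 + p\<^sup>2) - p * p = 2" "(p + p)\<^sup>2 = 4 * p\<^sup>2"
      by (simp_all add: power2_eq_square)
    then have "(1 + (1 + p\<^sup>2) - p * p) / (p + p)\<^sup>2 * (q\<^sup>2 / (1 + p\<^sup>2 + 1 + p * p) + p * r / 6)
        = (q / (2 * p))\<^sup>2 / (1 + p\<^sup>2) + r / (6 * p) / 2"
      using p pp by (simp add: power_divide distrib_left power2_eq_square)
    then show ?thesis
      by (simp add: error_constant_def p_def q_def r_def fact_numeral)
  qed
  ultimately have "((\<lambda>x. (1 + S x - a x * b x) / (a x + b x)\<^sup>2 *
        (((a x - p) / (x - \<alpha>) - (x - \<alpha>) * \<beta> x)\<^sup>2 / (S x + 1 + a x * b x) + T x)) \<longlongrightarrow>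
      error_constant f \<alpha>) (at \<alpha>)"
    by simp
  moreover have "\<forall>\<^sub>F x in at \<alpha>. a x + b x \<noteq> 0"
    by (rule tendsto_imp_eventually_ne[OF sum]) (use p in simp)
  then have "\<forall>\<^sub>F x in at \<alpha>. (1 + S x - a x * b x) / (a x + b x)\<^sup>2 *
        (((a x - p) / (x - \<alpha>) - (x - \<alpha>) * \<beta> x)\<^sup>2 / (S x + 1 + a x * b x) + T x) =
      (method_step f x - \<alpha>) / (x - \<alpha>) ^ 3"
    using tendsto_imp_eventually_ne[OF den den0] eventually_neq_at_within[of \<alpha>]
  proof eventually_elim
    case (elim x)
    define e F where "e = x - \<alpha>" and "F = f x / e"
    have e: "e \<noteq> 0" using elim by (simp add: e_def)
    have ms: "method_step f x - \<alpha> = e - e * F * ((1 + S x - a x * b x) / (a x + b x))"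
      using e by (simp add: method_step_def Let_def a_def b_def S_def F_def) (simp add: e_def)
    have T': "(2 * a x * b x - F * (a x + b x)) / e\<^sup>2 = T x"
      unfolding T_def \<rho>_def \<phi>_def \<beta>_def F_def
      using bracket_expansion_identity[OF e, of "a x" "b x" "f x / e" p q]
      unfolding e_def .
    have "(a x - p) / e - e * \<beta> x = (a x - b x) / e"
      unfolding \<beta>_def e_def[symmetric] using e by (simp add: field_simps power2_eq_square)
    then have D': "((a x - p) / e - e * \<beta> x)\<^sup>2 = (a x - b x)\<^sup>2 / e\<^sup>2"
      by (simp add: power_divide)
    have "(method_step f x - \<alpha>) / e ^ 3 = (1 + S x - a x * b x) / (a x + b x)\<^sup>2 *
        (((a x - b x)\<^sup>2 / (S x + 1 + a x * b x) + (2 * a x * b x - F * (a x + b x))) / e\<^sup>2)"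
      unfolding ms using step_error_identity[of "a x" "b x" e F, folded S_def, OF elim(1,2)] e
      by (simp add: power3_eq_cube power2_eq_square add_diff_eq mult.assoc)
    also have "\<dots> = (1 + S x - a x * b x) / (a x + b x)\<^sup>2 *
        ((a x - b x)\<^sup>2 / e\<^sup>2 / (S x + 1 + a x * b x) + T x)"
      unfolding T'[symmetric] by (simp add: add_divide_distrib mult.commute)
    finally show ?case
      unfolding e_def[symmetric] D' by simp
  qed
  ultimately show ?thesis
    by (rule Lim_transform_eventually)
qed

section \<open>From one step to the whole sequence\<close>

lemma method_step_root: "method_step f \<alpha> = \<alpha>"
  by (simp add: method_step_def root_values)

text \<open>A sequence that avoids its limit \<alpha> tends to it along \<open>at \<alpha>\<close>,
  so the one-step limit can be composed with it. Uniqueness of limits then decides whether a nonzero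
  \<zeta> exists.\<close>

lemma method_sequence_error:
  assumes "method_sequence f x" "x \<longlonglongrightarrow> \<alpha>" "\<forall>n. x n \<noteq> \<alpha>"
  shows "(\<lambda>n. (x (Suc n) - \<alpha>) / (x n - \<alpha>) ^ 3) \<longlonglongrightarrow> error_constant f \<alpha>"
    and "has_convergence_order f \<alpha> x 3 \<longleftrightarrow> error_constant f \<alpha> \<noteq> 0"
proof -
  have "filterlim x (at \<alpha>) sequentially"
    using assms by (simp add: filterlim_at)
  from filterlim_compose[OF method_step_error this]
  show lim: "(\<lambda>n. (x (Suc n) - \<alpha>) / (x n - \<alpha>) ^ 3) \<longlonglongrightarrow> error_constant f \<alpha>"
    using assms(1) by (simp add: method_sequence_def)
  \<comment> \<open>The exponent 3 falls under the natural-number case of \<open>real_power\<close>,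
    giving the signed cube.\<close>
  have "(3 :: real) \<in> \<nat>" "nat \<lfloor>3 :: real\<rfloor> = 3"
    by (simp_all only: Nats_numeral floor_numeral nat_numeral)
  then have "real_power t 3 = t ^ 3" for t
    unfolding real_power_def by (simp only: if_True)
  then have "has_convergence_order f \<alpha> x 3 \<longleftrightarrow>
      (\<exists>\<zeta>. \<zeta> \<noteq> 0 \<and> (\<lambda>n. (x (Suc n) - \<alpha>) / (x n - \<alpha>) ^ 3) \<longlonglongrightarrow> \<zeta>)"
    using root assms(2) by (simp add: has_convergence_order_def)
  also have "\<dots> \<longleftrightarrow> error_constant f \<alpha> \<noteq> 0"
    using lim LIMSEQ_unique by blast
  finally show "has_convergence_order f \<alpha> x 3 \<longleftrightarrow> error_constant f \<alpha> \<noteq> 0" .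
qed

text \<open>All the properties hold eventually near \<alpha>, so a single radius serves them; it is
  then shrunk until the iteration halves errors. A step hitting \<alpha> from another point would
  give quotient 0, which a nonzero limit excludes nearby.\<close>

lemma method_local_behaviour:
  obtains \<epsilon> K where "\<epsilon> > 0" "K \<ge> 0" "K * \<epsilon>\<^sup>2 \<le> 1 / 2"
    and "\<And>t. \<bar>t - \<alpha>\<bar> < \<epsilon> \<Longrightarrow> step_well_defined f U t"
    and "\<And>t. \<bar>t - \<alpha>\<bar> < \<epsilon> \<Longrightarrow> \<bar>method_step f t - \<alpha>\<bar> \<le> K * \<bar>t - \<alpha>\<bar> ^ 3"
    and "\<And>t. \<bar>t - \<alpha>\<bar> < \<epsilon> \<Longrightarrow> t \<noteq> \<alpha> \<Longrightarrow> error_constant f \<alpha> \<noteq> 0 \<Longrightarrow> method_step f t \<noteq> \<alpha>"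
proof -
  \<comment> \<open>Adding 1 puts \<open>K\<close> strictly above the limit of the absolute
    quotients and keeps it positive when the error constant vanishes.\<close>
  define K where "K = \<bar>error_constant f \<alpha>\<bar> + 1"
  have K: "K > 0" by (simp add: K_def)
  have "\<forall>\<^sub>F t in at \<alpha>. \<bar>(method_step f t - \<alpha>) / (t - \<alpha>) ^ 3\<bar> < K"
    by (rule order_tendstoD(2)[OF tendsto_rabs[OF method_step_error]]) (simp add: K_def)
  then have 1: "\<forall>\<^sub>F t in nhds \<alpha>. \<bar>method_step f t - \<alpha>\<bar> \<le> K * \<bar>t - \<alpha>\<bar> ^ 3"
    unfolding eventually_at_filter
  proof eventually_elim
    case (elim t)
    then show ?case
      \<comment> \<open>The quotient limit says nothing at \<alpha> itself; there both sides are 0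
        because the step fixes \<alpha>.\<close>
      by (cases "t = \<alpha>") (auto simp: method_step_root abs_divide power_abs field_simps)
  qed
  have 2: "\<forall>\<^sub>F t in nhds \<alpha>. t \<noteq> \<alpha> \<longrightarrow> error_constant f \<alpha> \<noteq> 0 \<longrightarrow> method_step f t \<noteq> \<alpha>"
  proof (cases "error_constant f \<alpha> = 0")
    case False
    then show ?thesis
      using tendsto_imp_eventually_ne[OF method_step_error False]
      unfolding eventually_at_filter by eventually_elim auto
  qed simp
  from eventually_conj[OF eventually_step_well_defined eventually_conj[OF 1 2]]
  obtain d where d: "d > 0"
    "\<And>t. \<bar>t - \<alpha>\<bar> < d \<Longrightarrow> step_well_defined f U t"
    "\<And>t. \<bar>t - \<alpha>\<bar> < d \<Longrightarrow> \<bar>method_step f t - \<alpha>\<bar> \<le> K * \<bar>t - \<alpha>\<bar> ^ 3"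
    "\<And>t. \<bar>t - \<alpha>\<bar> < d \<Longrightarrow> t \<noteq> \<alpha> \<Longrightarrow> error_constant f \<alpha> \<noteq> 0 \<Longrightarrow> method_step f t \<noteq> \<alpha>"
    unfolding eventually_nhds_metric dist_real_def by metis
  show ?thesis
  \<comment> \<open>The second bound on the radius is the solution of
    \<open>K * \<epsilon>^2 = 1 / 2\<close>.\<close>
  proof (rule that[of "min d (sqrt (1 / (2 * K)))" K])
    have "(min d (sqrt (1 / (2 * K))))\<^sup>2 \<le> (sqrt (1 / (2 * K)))\<^sup>2"
      using d(1) K by (intro power_mono) auto
    then show "K * (min d (sqrt (1 / (2 * K))))\<^sup>2 \<le> 1 / 2"
      using K by (simp add: field_simps)
  qed (use d K in auto)
qed

end

text \<open>Since the error constant can vanish, exact order three is tied to its being nonzero,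
  while local convergence and the cubic bound hold in every case.\<close>

theorem theorem2p1:
  fixes f :: "real \<Rightarrow> real" and \<alpha> :: real and U :: "real set"
  assumes "open U" and "\<alpha> \<in> U"
    and "cont_differentiable_on 3 f U"
    and "simple_root f \<alpha>"
  shows
    "(\<exists>\<epsilon>>0. \<exists>K. \<forall>x. method_sequence f x \<and> \<bar>x 0 - \<alpha>\<bar> < \<epsilon> \<longrightarrow>
        (\<forall>n. step_well_defined f U (x n)) \<and>
        x \<longlonglongrightarrow> \<alpha> \<and>
        (\<forall>n. \<bar>x (Suc n) - \<alpha>\<bar> \<le> K * \<bar>x n - \<alpha>\<bar> ^ 3) \<and>
        (x 0 \<noteq> \<alpha> \<and> error_constant f \<alpha> \<noteq> 0 \<longrightarrow>
           (\<forall>n. x n \<noteq> \<alpha>) \<and> has_convergence_order f \<alpha> x 3)) \<and>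
     (\<forall>x. method_sequence f x \<and> x \<longlonglongrightarrow> \<alpha> \<and> (\<forall>n. x n \<noteq> \<alpha>) \<longrightarrow>
        (\<lambda>n. (x (Suc n) - \<alpha>) / (x n - \<alpha>) ^ 3) \<longlonglongrightarrow> error_constant f \<alpha> \<and>
        (has_convergence_order f \<alpha> x 3 \<longleftrightarrow> error_constant f \<alpha> \<noteq> 0))"
proof -
  obtain \<epsilon> K where \<epsilon>: "\<epsilon> > 0" and K: "K \<ge> 0" "K * \<epsilon>\<^sup>2 \<le> 1 / 2"
    and wd: "\<And>t. \<bar>t - \<alpha>\<bar> < \<epsilon> \<Longrightarrow> step_well_defined f U t"
    and cubic: "\<And>t. \<bar>t - \<alpha>\<bar> < \<epsilon> \<Longrightarrow> \<bar>method_step f t - \<alpha>\<bar> \<le> K * \<bar>t - \<alpha>\<bar> ^ 3"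
    and ne: "\<And>t. \<bar>t - \<alpha>\<bar> < \<epsilon> \<Longrightarrow> t \<noteq> \<alpha> \<Longrightarrow> error_constant f \<alpha> \<noteq> 0 \<Longrightarrow> method_step f t \<noteq> \<alpha>"
    using method_local_behaviour[OF assms] by metis
  have "(\<forall>n. step_well_defined f U (x n)) \<and> x \<longlonglongrightarrow> \<alpha> \<and>
      (\<forall>n. \<bar>x (Suc n) - \<alpha>\<bar> \<le> K * \<bar>x n - \<alpha>\<bar> ^ 3) \<and>
      (x 0 \<noteq> \<alpha> \<and> error_constant f \<alpha> \<noteq> 0 \<longrightarrow> (\<forall>n. x n \<noteq> \<alpha>) \<and> has_convergence_order f \<alpha> x 3)"
    if x: "method_sequence f x" "\<bar>x 0 - \<alpha>\<bar> < \<epsilon>" for x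
  proof -
    have step: "\<And>n. x (Suc n) = method_step f (x n)"
      using x(1) by (simp add: method_sequence_def)
    note conv = cubic_convergence[of \<alpha> \<epsilon> "method_step f" K x, OF cubic K(2,1) step x(2)]
    \<comment> \<open>The iterates stay within \<epsilon>, where no step from a point other than
      \<alpha> lands on \<alpha>.\<close>
    have "x n \<noteq> \<alpha>" if "x 0 \<noteq> \<alpha>" "error_constant f \<alpha> \<noteq> 0" for n
      by (induction n) (use that conv(1) ne in \<open>auto simp: step\<close>)
    then show ?thesis
      using wd cubic conv method_sequence_error(2)[OF assms x(1) conv(2)] by (auto simp: step)
  qed
  then show ?thesis
    using \<epsilon> method_sequence_error[OF assms] by blast
qed

end
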